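(* Let $a,b,c$ be real numbers with $\max\{a^2,b^2\}+c^2\le 1$, and let $\Delta_{a,b,c}:\mathbb{M}_2(\mathbb{C})\to\mathbb{M}_2(\mathbb{C})\otimes\mathbb{M}_2(\mathbb{C})$ be the linear operator given by $$\Delta_{a,b,c}(\mathbf 1)=\mathbf 1\otimes\mathbf 1,\quad \Delta_{a,b,c}(\sigma_1)=\sigma_1\otimes\sigma_1,\quad \Delta_{a,b,c}(\sigma_2)=a\,\sigma_2\otimes\sigma_2+b\,\sigma_3\otimes\sigma_3,\quad \Delta_{a,b,c}(\sigma_3)=c\,\sigma_3\otimes\sigma_3 .$$ If $|a|+|b|>1$, then $\Delta_{a,b,c}$ is not a Kadison-Schwarz operator.
   Context: $\mathbf 1$ is the identity of $\mathbb{M}_2(\mathbb{C})$ and $\sigma_1=\begin{pmatrix}0&1\\1&0\end{pmatrix}$, $\sigma_2=\begin{pmatrix}0&-i\\ i&0\end{pmatrix}$, $\sigma_3=\begin{pmatrix}1&0\\0&-1\end{pmatrix}$ are the Pauli matrices. A linear map $\Delta:\mathbb{M}_2(\mathbb{C})\to\mathbb{M}_2(\mathbb{C})\otimes\mathbb{M}_2(\mathbb{C})$ is a Kadison-Schwarz operator if $\Delta(x^*x)\ge\Delta(x)^*\Delta(x)$ for all $x\in\mathbb{M}_2(\mathbb{C})$. ($\Delta_{a,b,c}$ is the operator $\Delta(\sigma_k)=\sum_{i,j}b_{ij,k}\sigma_i\otimes\sigma_j$ whose coefficients are those of the quadratic operator $V(\mathbf f)=(f_1^2,\ af_2^2+bf_3^2,\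 cf_3^2)$, $V(\mathbf f)_k=\sum_{i,j}b_{ij,k}f_if_j$, with $b_{ij,k}=0$ for $i\ne j$.) *)

theory Defs
  imports "HOL-Analysis.Analysis"
begin

type_synonym 'n cmat = "complex ^ 'n ^ 'n"

definition pauli1 :: "2 cmat" where
  "pauli1 = vector [vector [0, 1], vector [1, 0]]"

definition pauli2 :: "2 cmat" where
  "pauli2 = vector [vector [0, - \<i>], vector [\<i>, 0]]"

definition pauli3 :: "2 cmat" where
  "pauli3 = vector [vector [1, 0], vector [0, - 1]]"

definition cscale :: "complex \<Rightarrow> 'n::finite cmat \<Rightarrow> 'n cmat" where
  "cscale z A = map_matrix ((*) z) A"

definition conj_transpose :: "'n::finite cmat \<Rightarrow> 'n cmat" where
  "conj_transpose A = map_matrix cnj (transpose A)"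

text \<open>The tensor product of two full matrix algebras is realised as the full matrix algebra whose
  index set is the product of the two index sets, with the Kronecker product as elementary tensor;
  product, adjoint and order on the tensor product are then those of matrices.\<close>

definition kron :: "'m::finite cmat \<Rightarrow> 'n::finite cmat \<Rightarrow> ('m \<times> 'n) cmat"  (infixr "\<otimes>\<^sub>K" 72) where
  "A \<otimes>\<^sub>K B = (\<chi> p q. A $ fst p $ fst q * B $ snd p $ snd q)"

text \<open>Since the scalars are complex, real-valuedness of the form forces the matrix to be
  self-adjoint.\<close>

definition pos_semidef :: "'n::finite cmat \<Rightarrow> bool" where
  "pos_semidef A \<longleftrightarrow> (\<forall>v. (\<Sum>i\<in>UNIV. cnj (v $ i) * (A *v v) $ i) \<in> \<real>\<^sub>\<ge>\<^sub>0)"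

definition loewner_le :: "'n::finite cmat \<Rightarrow> 'n cmat \<Rightarrow> bool"  (infix "\<le>\<^sub>L" 50) where
  "A \<le>\<^sub>L B \<longleftrightarrow> pos_semidef (B - A)"

lemma vector_space_cscale: "vector_space (cscale :: complex \<Rightarrow> 'n::finite cmat \<Rightarrow> 'n cmat)"
  by unfold_locales (simp_all add: cscale_def map_matrix_def vec_eq_iff algebra_simps)

abbreviation clinear_map :: "('m::finite cmat \<Rightarrow> 'n::finite cmat) \<Rightarrow> bool" where
  "clinear_map \<equiv> Vector_Spaces.linear cscale cscale"

definition kadison_schwarz :: "('m::finite cmat \<Rightarrow> 'n::finite cmat) \<Rightarrow> bool" where
  "kadison_schwarz \<Delta> \<longleftrightarrow> clinear_map \<Delta> \<and>
     (\<forall>x. conj_transpose (\<Delta> x) ** \<Delta> x \<le>\<^sub>L \<Delta> (conj_transpose x ** x))"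

text \<open>The identity and the Pauli matrices are a basis, so exactly one operator satisfies these
  conditions (see \<open>is_Delta_exists\<close> and \<open>is_Delta_unique\<close>).\<close>

definition is_Delta :: "real \<Rightarrow> real \<Rightarrow> real \<Rightarrow> (2 cmat \<Rightarrow> (2 \<times> 2) cmat) \<Rightarrow> bool" where
  "is_Delta a b c \<Delta> \<longleftrightarrow>
     clinear_map \<Delta> \<and>
     \<Delta> (mat 1) = mat 1 \<otimes>\<^sub>K mat 1 \<and>
     \<Delta> pauli1 = pauli1 \<otimes>\<^sub>K pauli1 \<and>
     \<Delta> pauli2 = cscale (of_real a) (pauli2 \<otimes>\<^sub>K pauli2) + cscale (of_real b) (pauli3 \<otimes>\<^sub>K pauli3) \<and>
     \<Delta> pauli3 = cscale (of_real c) (pauli3 \<otimes>\<^sub>K pauli3)"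

lemma pauli_entries:
  "(mat 1 :: 2 cmat)$1$1 = 1" "(mat 1 :: 2 cmat)$1$2 = 0"
  "(mat 1 :: 2 cmat)$2$1 = 0" "(mat 1 :: 2 cmat)$2$2 = 1"
  "pauli1$1$1 = 0" "pauli1$1$2 = 1" "pauli1$2$1 = 1" "pauli1$2$2 = 0"
  "pauli2$1$1 = 0" "pauli2$1$2 = - \<i>" "pauli2$2$1 = \<i>" "pauli2$2$2 = 0"
  "pauli3$1$1 = 1" "pauli3$1$2 = 0" "pauli3$2$1 = 0" "pauli3$2$2 = - 1"
  by (simp_all add: mat_def pauli1_def pauli2_def pauli3_def)

lemma cscale_0: "cscale 0 A = 0" and cscale_1: "cscale 1 A = A"
  by (simp_all add: vec_eq_iff cscale_def map_matrix_def)

lemma cscale_entry: "cscale z A $ i $ j = z * A $ i $ j"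
  by (simp add: cscale_def map_matrix_def)

lemma clinear_map_pauli:
  fixes P Q R S :: "'n::finite cmat"
  shows "clinear_map (\<lambda>x::2 cmat. cscale ((x$1$1 + x$2$2) / 2) P + cscale ((x$1$2 + x$2$1) / 2) Q
     + cscale (\<i> * (x$1$2 - x$2$1) / 2) R + cscale ((x$1$1 - x$2$2) / 2) S)"
  unfolding Vector_Spaces.linear_def module_hom_def module_hom_axioms_def module_iff_vector_space
  by (intro conjI allI vector_space_cscale;
      simp only: vec_eq_iff vector_add_component cscale_entry; intro allI;
      simp add: algebra_simps add_divide_distrib diff_divide_distrib)

lemma pauli_decomposition:
  "x = cscale ((x$1$1 + x$2$2) / 2) (mat 1) + cscale ((x$1$2 + x$2$1) / 2) pauli1
     + cscale (\<i> * (x$1$2 - x$2$1) / 2) pauli2 + cscale ((x$1$1 - x$2$2) / 2) pauli3"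
  by (simp add: vec_eq_iff forall_2 cscale_entry pauli_entries field_simps)

lemma is_Delta_exists: "\<exists>\<Delta>. is_Delta a b c \<Delta>"
  by (rule exI, unfold is_Delta_def, intro conjI, rule clinear_map_pauli[where
        P = "mat 1 \<otimes>\<^sub>K mat 1" and Q = "pauli1 \<otimes>\<^sub>K pauli1" and
        R = "cscale (of_real a) (pauli2 \<otimes>\<^sub>K pauli2) + cscale (of_real b) (pauli3 \<otimes>\<^sub>K pauli3)" and
        S = "cscale (of_real c) (pauli3 \<otimes>\<^sub>K pauli3)"])
     (simp_all add: pauli_entries cscale_0 cscale_1)

lemma is_Delta_unique:
  assumes "is_Delta a b c D" and "is_Delta a b c E"
  shows "D = E"
proof
  fix x
  have lin: "F (cscale p A + cscale q B + cscale r C + cscale s G)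
      = cscale p (F A) + cscale q (F B) + cscale r (F C) + cscale s (F G)"
    if "is_Delta a b c F" for F p q r s A B C G
  proof -
    have "clinear_map F" using that unfolding is_Delta_def by (rule conjunct1)
    then have "module_hom cscale cscale F" by (simp only: Vector_Spaces.linear_def)
    then show ?thesis by (simp only: module_hom.add module_hom.scale)
  qed
  have val: "D (mat 1) = E (mat 1)" "D pauli1 = E pauli1" "D pauli2 = E pauli2" "D pauli3 = E pauli3"
    using assms unfolding is_Delta_def by simp_all
  obtain p q r s where x: "x = cscale p (mat 1) + cscale q pauli1 + cscale r pauli2 + cscale s pauli3"
    by (rule that[OF pauli_decomposition])
  show "D x = E x"
    unfolding x lin[OF assms(1)] lin[OF assms(2)] val ..
qed

end

theory Submission
  imports Defs
begin

text \<open>A Kadison-Schwarz operator maps \<open>x\<^sup>* x\<close> to a positive matrix. With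
  \<open>x = \<sigma>\<^sub>3 + i\<epsilon>\<sigma>\<^sub>1\<close>, \<open>\<epsilon> = \<plusminus>1\<close>, one has \<open>x\<^sup>* x = 2(1 - \<epsilon>\<sigma>\<^sub>2)\<close>. The vectors
  \<open>e\<^sub>1 \<otimes> e\<^sub>1 + \<tau> e\<^sub>2 \<otimes> e\<^sub>2\<close>, \<open>\<tau> = \<plusminus>1\<close>, are joint eigenvectors of \<open>\<sigma>\<^sub>2 \<otimes> \<sigma>\<^sub>2\<close> and
  \<open>\<sigma>\<^sub>3 \<otimes> \<sigma>\<^sub>3\<close> with eigenvalues \<open>-\<tau>\<close> and \<open>1\<close>, so positivity forces \<open>\<epsilon>(b - \<tau>a) \<le> 1\<close> for all signs,
  that is \<open>\<bar>a\<bar> + \<bar>b\<bar> \<le> 1\<close>.\<close>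

lemma pos_semidef_add:
  assumes "pos_semidef A" "pos_semidef B"
  shows "pos_semidef (A + B)"
  using assms nonneg_Reals_add_I
  by (auto simp: pos_semidef_def matrix_vector_mult_add_rdistrib distrib_left sum.distrib)

text \<open>Moving the adjoint across the form turns its value at \<open>v\<close> into the squared
  norm of \<open>B *v v\<close>.\<close>

lemma pos_semidef_conj_transpose_mult:
  fixes B :: "'n::finite cmat"
  shows "pos_semidef (conj_transpose B ** B)"
  unfolding pos_semidef_def
proof
  fix v :: "complex ^ 'n"
  let ?w = "B *v v"
  have "(\<Sum>i\<in>UNIV. cnj (v $ i) * ((conj_transpose B ** B) *v v) $ i)
      = (\<Sum>i\<in>UNIV. cnj (v $ i) * (conj_transpose B *v ?w) $ i)"
    by (simp add: matrix_vector_mul_assoc)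
  also have "\<dots> = (\<Sum>i\<in>UNIV. \<Sum>j\<in>UNIV. cnj (v $ i) * cnj (B $ j $ i) * ?w $ j)"
    by (simp add: conj_transpose_def map_matrix_def transpose_def matrix_vector_mult_def[of _ ?w]
        sum_distrib_left mult.assoc)
  also have "\<dots> = (\<Sum>j\<in>UNIV. \<Sum>i\<in>UNIV. cnj (v $ i) * cnj (B $ j $ i) * ?w $ j)"
    by (rule sum.swap)
  also have "\<dots> = (\<Sum>j\<in>UNIV. cnj (?w $ j) * ?w $ j)"
  proof (rule sum.cong[OF refl])
    fix j
    have "cnj (?w $ j) = (\<Sum>i\<in>UNIV. cnj (v $ i) * cnj (B $ j $ i))"
      by (simp add: matrix_vector_mult_def mult.commute)
    then show "(\<Sum>i\<in>UNIV. cnj (v $ i) * cnj (B $ j $ i) * ?w $ j) = cnj (?w $ j) * ?w $ j"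
      by (simp add: sum_distrib_right)
  qed
  also have "\<dots> = of_real (\<Sum>j\<in>UNIV. (cmod (?w $ j))\<^sup>2)"
    by (simp add: complex_norm_square mult.commute del: of_real_power)
  also have "\<dots> \<in> \<real>\<^sub>\<ge>\<^sub>0"
    by (simp add: sum_nonneg del: of_real_sum)
  finally show "(\<Sum>i\<in>UNIV. cnj (v $ i) * ((conj_transpose B ** B) *v v) $ i) \<in> \<real>\<^sub>\<ge>\<^sub>0" .
qed

text \<open>The subtracted term in the Kadison-Schwarz inequality is itself positive, so adding it
  back preserves positivity.\<close>

lemma kadison_schwarz_pos_semidef:
  assumes "kadison_schwarz \<Delta>"
  shows "pos_semidef (\<Delta> (conj_transpose x ** x))"
proof -
  have "pos_semidef (\<Delta> (conj_transpose x ** x) - conj_transpose (\<Delta> x) ** \<Delta> x)"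
    using assms by (simp add: kadison_schwarz_def loewner_le_def)
  from pos_semidef_add[OF this pos_semidef_conj_transpose_mult[of "\<Delta> x"]] show ?thesis
    by simp
qed

lemma sum_UNIV_2_times_2:
  "(\<Sum>p\<in>UNIV. f p) = f (1,1) + f (1,2) + f (2,1) + f (2::2,2::2)"
  for f :: "2 \<times> 2 \<Rightarrow> 'a::comm_monoid_add"
  unfolding UNIV_Times_UNIV[symmetric] sum.cartesian_product' by (simp add: sum_2 add.assoc)

lemma is_Delta_pos_semidef_bound:
  fixes a b c \<epsilon> \<tau> :: real
  assumes D: "is_Delta a b c \<Delta>" and KS: "kadison_schwarz \<Delta>"
    and \<epsilon>: "\<epsilon>\<^sup>2 = 1" and \<tau>: "\<tau>\<^sup>2 = 1"
  shows "\<epsilon> * (b - \<tau> * a) \<le> 1"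
proof -
  define x :: "2 cmat" where "x = pauli3 + cscale (\<i> * of_real \<epsilon>) pauli1"
  define v :: "complex ^ (2 \<times> 2)"
    where "v = (\<chi> p. if p = (1,1) then 1 else if p = (2,2) then of_real \<tau> else 0)"
  have \<epsilon>': "complex_of_real \<epsilon> * of_real \<epsilon> = 1"
    using \<epsilon> by (metis of_real_1 of_real_mult power2_eq_square)
  \<comment> \<open>The squares contribute \<open>1 + \<epsilon>\<^sup>2 = 2\<close>; the cross
    terms form \<open>\<i> * \<epsilon>\<close> times the commutator of \<open>pauli3\<close> and
    \<open>pauli1\<close>, which is \<open>2 * \<i>\<close> times \<open>pauli2\<close>.\<close>
  have xx: "conj_transpose x ** x = cscale 2 (mat 1) + cscale (of_real (- 2 * \<epsilon>)) pauli2"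
    using \<epsilon>' by (simp add: x_def vec_eq_iff forall_2 matrix_matrix_mult_def sum_2 conj_transpose_def
        map_matrix_def transpose_def cscale_entry pauli_entries algebra_simps)
  have hom: "module_hom cscale cscale \<Delta>"
    using D by (simp add: is_Delta_def Vector_Spaces.linear_def)
  have "\<Delta> (conj_transpose x ** x) = cscale 2 (mat 1 \<otimes>\<^sub>K mat 1) + cscale (of_real (- 2 * \<epsilon>))
      (cscale (of_real a) (pauli2 \<otimes>\<^sub>K pauli2) + cscale (of_real b) (pauli3 \<otimes>\<^sub>K pauli3))"
    using D unfolding xx is_Delta_def by (simp only: module_hom.add[OF hom] module_hom.scale[OF hom])
  \<comment> \<open>At \<open>v\<close> the identity and
    \<open>pauli3 \<otimes>\<^sub>K pauli3\<close> both give \<open>1 + \<tau>\<^sup>2\<close>,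
    while \<open>pauli2 \<otimes>\<^sub>K pauli2\<close> gives \<open>- 2 * \<tau>\<close>.\<close>
  then have "(\<Sum>i\<in>UNIV. cnj (v $ i) * (\<Delta> (conj_transpose x ** x) *v v) $ i)
      = of_real (2 * (1 + \<tau>\<^sup>2) - 2 * \<epsilon> * (b + b * \<tau>\<^sup>2 - 2 * \<tau> * a))"
    by (simp add: sum_UNIV_2_times_2 matrix_vector_mult_def v_def cscale_entry kron_def pauli_entries
        power2_eq_square algebra_simps)
  moreover have "(\<Sum>i\<in>UNIV. cnj (v $ i) * (\<Delta> (conj_transpose x ** x) *v v) $ i) \<in> \<real>\<^sub>\<ge>\<^sub>0"
    using kadison_schwarz_pos_semidef[OF KS] by (simp add: pos_semidef_def)
  ultimately have "0 \<le> 2 * (1 + \<tau>\<^sup>2) - 2 * \<epsilon> * (b + b * \<tau>\<^sup>2 - 2 * \<tau> * a)"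
    by (simp only: nonneg_Reals_of_real_iff)
  then show ?thesis
    by (simp add: \<tau> algebra_simps)
qed

theorem theorem4p15:
  fixes a b c :: real and \<Delta> :: "2 cmat \<Rightarrow> (2 \<times> 2) cmat"
  assumes "max (a\<^sup>2) (b\<^sup>2) + c\<^sup>2 \<le> 1"
    and "is_Delta a b c \<Delta>"
    and "\<bar>a\<bar> + \<bar>b\<bar> > 1"
  shows "\<not> kadison_schwarz \<Delta>"
proof
  assume "kadison_schwarz \<Delta>"
  note bound = is_Delta_pos_semidef_bound[OF assms(2) this]
  show False
    \<comment> \<open>Among the four sign choices, one has
      \<open>\<epsilon> * b = \<bar>b\<bar>\<close> and
      \<open>- \<epsilon> * \<tau> * a = \<bar>a\<bar>\<close>.\<close>
    using bound[of 1 1] bound[of 1 "-1"] bound[of "-1" 1] bound[of "-1" "-1"] assms(3)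
    by (simp add: abs_if split: if_splits)
qed

end
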